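(* Let $\Phi:\mathbb{M}(n)\to\mathbb{M}(k)$ be a positive unital linear map. Let $A\in\mathbb{M}(n)$ be a Hermitian matrix whose spectrum is contained in the real interval $[m,M]$. If $A$ is positive definite, then for every $r=0,1,2,\ldots$, $$\left[\Phi(A^{i+j-2})-m\,\Phi(A^{i+j-3})\right]_{1\le i,j\le r+1}\ge O$$ and $$\left[M\,\Phi(A^{i+j-3})-\Phi(A^{i+j-2})\right]_{1\le i,j\le r+1}\ge O.$$
   Context: $\mathbb{M}(n)$ is the $C^*$-algebra of all $n\times n$ complex matrices. A linear map $\Phi:\mathbb{M}(n)\to\mathbb{M}(k)$ is positive if it sends positive semidefinite matrices to positive semidefinite matrices, and unital if $\Phi(I)=I$. $[X_{ij}]_{1\le i,j\le r+1}$ with $X_{ij}\in\mathbb{M}(k)$ denotes the $(r+1)\times(r+1)$ block matrix with blocks $X_{ij}$, viewed as an element of $\mathbb{M}((r+1)k)$. $X\ge O$ means $X$ is Hermitian positive semidefinite. $A^0=I$ and $A^{-1}$ is the inverse of $A$. *)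

theory Defs
  imports "Jordan_Normal_Form.Spectral_Radius"
begin

definition hermitian_mat :: "complex mat \<Rightarrow> bool" where
  "hermitian_mat A \<longleftrightarrow> square_mat A \<and> mat_adjoint A = A"

(* The inner product (A v) \<bullet>c v is v^* A v. The order on complex numbers is that of
   HOL-Library.Complex_Order: 0 \<le> z means that z is real and nonnegative. *)
definition pos_semidef_mat :: "complex mat \<Rightarrow> bool" where
  "pos_semidef_mat A \<longleftrightarrow> hermitian_mat A \<and>
     (\<forall>v \<in> carrier_vec (dim_row A). 0 \<le> (A *\<^sub>v v) \<bullet>c v)"

definition pos_def_mat :: "complex mat \<Rightarrow> bool" where
  "pos_def_mat A \<longleftrightarrow> hermitian_mat A \<and>
     (\<forall>v \<in> carrier_vec (dim_row A). v \<noteq> 0\<^sub>v (dim_row A) \<longrightarrow> 0 < (A *\<^sub>v v) \<bullet>c v)"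

(* Linear maps from M(n) to M(k): only the values on n x n matrices matter. *)
definition linear_mat_map :: "nat \<Rightarrow> nat \<Rightarrow> (complex mat \<Rightarrow> complex mat) \<Rightarrow> bool" where
  "linear_mat_map n k \<Phi> \<longleftrightarrow>
     (\<forall>A \<in> carrier_mat n n. \<Phi> A \<in> carrier_mat k k) \<and>
     (\<forall>A \<in> carrier_mat n n. \<forall>B \<in> carrier_mat n n. \<Phi> (A + B) = \<Phi> A + \<Phi> B) \<and>
     (\<forall>c. \<forall>A \<in> carrier_mat n n. \<Phi> (c \<cdot>\<^sub>m A) = c \<cdot>\<^sub>m \<Phi> A)"

definition positive_mat_map :: "nat \<Rightarrow> (complex mat \<Rightarrow> complex mat) \<Rightarrow> bool" where
  "positive_mat_map n \<Phi> \<longleftrightarrow>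
     (\<forall>A \<in> carrier_mat n n. pos_semidef_mat A \<longrightarrow> pos_semidef_mat (\<Phi> A))"

definition unital_mat_map :: "nat \<Rightarrow> nat \<Rightarrow> (complex mat \<Rightarrow> complex mat) \<Rightarrow> bool" where
  "unital_mat_map n k \<Phi> \<longleftrightarrow> \<Phi> (1\<^sub>m n) = 1\<^sub>m k"

(* Negative powers are meaningful for invertible A only. *)
definition mat_int_power :: "complex mat \<Rightarrow> int \<Rightarrow> complex mat" where
  "mat_int_power A z =
     (if 0 \<le> z then A ^\<^sub>m nat z else the (mat_inverse A) ^\<^sub>m nat (- z))"

(* The matrix of size p*k with the k x k blocks X i j, where 1 \<le> i, j \<le> p. Entries of
   matrices are indexed from 0, but the block indices passed to X start at 1. *)
definition block_mat :: "nat \<Rightarrow> nat \<Rightarrow> (nat \<Rightarrow> nat \<Rightarrow> complex mat) \<Rightarrow> complex mat" where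
  "block_mat p k X = mat (p * k) (p * k)
     (\<lambda>(a, b). X (a div k + 1) (b div k + 1) $$ (a mod k, b mod k))"

end

theory Submission
  imports Defs
begin

text \<open>
  Write A as the sum of \<open>\<mu>\<^sub>s P\<^sub>s\<close> with eigenvalues \<open>\<mu>\<^sub>s \<in> [m, M]\<close>, \<open>\<mu>\<^sub>s > 0\<close>, and orthogonal
  projections \<open>P\<^sub>s\<close> of rank one. Then \<open>\<Phi>(A\<^sup>z)\<close> is the sum of \<open>\<mu>\<^sub>s\<^sup>z Q\<^sub>s\<close> with \<open>Q\<^sub>s = \<Phi>(P\<^sub>s)\<close> positive
  semidefinite, so the first block matrix evaluated at a block vector v is the sum over s of
  \<open>(\<mu>\<^sub>s - m) / \<mu>\<^sub>s\<close> times the quadratic form of \<open>Q\<^sub>s\<close> at \<open>w\<^sub>s = \<Sum>i. \<mu>\<^sub>s\<^sup>i v\<^sub>i\<close> (blocks counted from 0).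
  The second one is the same with \<open>M - \<mu>\<^sub>s\<close> in place of \<open>\<mu>\<^sub>s - m\<close>.
\<close>

section \<open>Adjoints and Hermitian matrices\<close>

lemma mat_adjoint_dim [simp]:
  "dim_row (mat_adjoint A) = dim_col A" "dim_col (mat_adjoint A) = dim_row A"
  by (auto simp: mat_adjoint_def)

lemma mat_adjoint_carrier [simp]:
  "A \<in> carrier_mat n m \<Longrightarrow> mat_adjoint A \<in> carrier_mat m n"
  by (auto intro: carrier_matI)

lemma mat_adjoint_index [simp]:
  "i < dim_col A \<Longrightarrow> j < dim_row A \<Longrightarrow> mat_adjoint A $$ (i, j) = conjugate (A $$ (j, i))"
  by (auto simp: mat_adjoint_def mat_of_rows_index)

lemma mat_adjoint_adjoint [simp]: "mat_adjoint (mat_adjoint A) = A"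
  by (rule eq_matI) auto

lemma mat_adjoint_mult:
  assumes "A \<in> carrier_mat n m" "B \<in> carrier_mat m l"
  shows "mat_adjoint (A * B) = mat_adjoint B * mat_adjoint (A :: complex mat)"
  using assms by (intro eq_matI) (auto simp: scalar_prod_def cnj_sum mult.commute)

lemma cscalar_prod_adjoint:
  fixes A :: "complex mat"
  assumes "A \<in> carrier_mat n m" "v \<in> carrier_vec m" "w \<in> carrier_vec n"
  shows "(A *\<^sub>v v) \<bullet>c w = v \<bullet>c (mat_adjoint A *\<^sub>v w)"
proof -
  have "(A *\<^sub>v v) \<bullet>c w = (\<Sum>i<n. \<Sum>j<m. A $$ (i, j) * v $ j * cnj (w $ i))"
    using assms by (auto simp: scalar_prod_def sum_distrib_right atLeast0LessThan)
  also have "\<dots> = (\<Sum>j<m. \<Sum>i<n. A $$ (i, j) * v $ j * cnj (w $ i))"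
    by (rule sum.swap)
  also have "\<dots> = v \<bullet>c (mat_adjoint A *\<^sub>v w)"
    using assms
    by (auto simp: scalar_prod_def sum_distrib_left atLeast0LessThan cnj_sum ac_simps intro!: sum.cong)
  finally show ?thesis .
qed

lemma hermitian_mat_iff:
  assumes "A \<in> carrier_mat n n"
  shows "hermitian_mat A \<longleftrightarrow> (\<forall>i<n. \<forall>j<n. A $$ (i, j) = cnj (A $$ (j, i)))"
proof
  assume "hermitian_mat A"
  then have "mat_adjoint A = A" by (simp add: hermitian_mat_def)
  then show "\<forall>i<n. \<forall>j<n. A $$ (i, j) = cnj (A $$ (j, i))"
    using assms by (metis carrier_matD conjugate_complex_def mat_adjoint_index)
next
  assume *: "\<forall>i<n. \<forall>j<n. A $$ (i, j) = cnj (A $$ (j, i))"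
  have "mat_adjoint A = A"
  proof (rule eq_matI)
    fix i j assume "i < dim_row A" "j < dim_col A"
    then have ij: "i < n" "j < n" using assms by auto
    then show "mat_adjoint A $$ (i, j) = A $$ (i, j)"
      using assms *[rule_format, OF ij] by simp
  qed (use assms in auto)
  then show "hermitian_mat A" using assms by (auto simp: hermitian_mat_def)
qed

text \<open>The quadratic form of an orthogonal projection at \<open>v\<close> is the squared norm
  of \<open>X *\<^sub>v v\<close>: split \<open>X\<close> as \<open>X * X\<close> and move one
  factor to the other side.\<close>

lemma pos_semidef_mat_hermitian_idem:
  assumes "X \<in> carrier_mat n n" "hermitian_mat X" "X * X = X"
  shows "pos_semidef_mat X"
proof -
  have "0 \<le> (X *\<^sub>v v) \<bullet>c v" if v: "v \<in> carrier_vec n" for v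
  proof -
    have "(X *\<^sub>v v) \<bullet>c v = (X *\<^sub>v (X *\<^sub>v v)) \<bullet>c v"
      using assms v by (metis assoc_mult_mat_vec)
    also have "\<dots> = (X *\<^sub>v v) \<bullet>c (X *\<^sub>v v)"
      using assms v cscalar_prod_adjoint[of X n n "X *\<^sub>v v" v] by (simp add: hermitian_mat_def)
    finally show ?thesis by auto
  qed
  then show ?thesis using assms by (auto simp: pos_semidef_mat_def)
qed

section \<open>Unitary completion and the spectral theorem\<close>

text \<open>Complete \<open>v\<close> to a basis, orthogonalise by Gram-Schmidt and normalise. The
  scalar \<open>c\<close> is the normalising factor of \<open>v\<close>; the spectral theorem takes
  an eigenvector for \<open>v\<close>.\<close>

lemma unitary_with_first_column:
  fixes v :: "complex vec"
  assumes v: "v \<in> carrier_vec n" and v0: "v \<noteq> 0\<^sub>v n"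
  obtains U c where "U \<in> carrier_mat n n" "mat_adjoint U * U = 1\<^sub>m n" "col U 0 = c \<cdot>\<^sub>v v"
proof -
  interpret cof_vec_space n "TYPE(complex)" .
  have n: "n \<noteq> 0" using v v0 by auto
  define b where "b = basis_completion v"
  define ws where "ws = gram_schmidt n b"
  note bc = basis_completion[OF v v0, folded b_def]
  obtain vs where b: "b = v # vs" using bc(6,7) n by (cases b) auto
  have ws: "set ws \<subseteq> carrier_vec n" "corthogonal ws" "length ws = n"
    using gram_schmidt_result[OF bc(2,4,5) ws_def] bc(6) by auto
  \<comment> \<open>Gram-Schmidt leaves the first vector unchanged.\<close>
  have "hd ws = v" unfolding ws_def b using v by simp
  then have ws0: "ws ! 0 = v" using ws(3) n by (metis hd_conv_nth list.size(3))
  have wsc: "ws ! i \<in> carrier_vec n" if "i < n" for i using ws that by auto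
  \<comment> \<open>The reciprocal of the norm of \<open>ws ! i\<close>; \<open>Re\<close> only
    turns the real number \<open>ws ! i \<bullet>c ws ! i\<close> into one of type
    \<open>real\<close>.\<close>
  define g where "g i = complex_of_real (1 / sqrt (Re (ws ! i \<bullet>c ws ! i)))" for i
  define U where "U = mat_of_cols n (map (\<lambda>i. g i \<cdot>\<^sub>v ws ! i) [0..<n])"
  have U: "U \<in> carrier_mat n n" unfolding U_def by (auto intro: carrier_matI)
  have col: "col U i = g i \<cdot>\<^sub>v ws ! i" if "i < n" for i
    unfolding U_def using that wsc by (subst col_mat_of_cols) auto
  have "mat_adjoint U * U = 1\<^sub>m n"
  proof (rule eq_matI)
    fix i j assume "i < dim_row (1\<^sub>m n :: complex mat)" "j < dim_col (1\<^sub>m n :: complex mat)"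
    then have i: "i < n" and j: "j < n" by auto
    have "(mat_adjoint U * U) $$ (i, j) = col U j \<bullet>c col U i"
      using U i j by (auto simp: scalar_prod_def mult.commute)
    also have "\<dots> = g i * g j * (ws ! j \<bullet>c ws ! i)"
      using wsc[OF i] wsc[OF j] by (simp add: col[OF i] col[OF j] conjugate_smult_vec g_def)
    also have "\<dots> = (if i = j then 1 else 0)"
    proof (cases "i = j")
      case True
      \<comment> \<open>\<open>corthogonal\<close> says that an inner product vanishes exactly for
        distinct indices, so it also excludes zero vectors.\<close>
      have "ws ! i \<bullet>c ws ! i > 0"
        using corthogonalD[OF ws(2), of i i] i ws(3) conjugate_square_ge_0_vec[of "ws ! i"]
        by (auto simp: order.order_iff_strict)
      then obtain x where "x > 0" "ws ! i \<bullet>c ws ! i = complex_of_real x"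
        by (metis complex_is_Real_iff less_complex_def of_real_Re zero_complex.simps)
      then show ?thesis
        using True by (simp add: g_def flip: of_real_mult)
    next
      case False
      then show ?thesis using corthogonalD[OF ws(2), of j i] i j ws(3) by auto
    qed
    finally show "(mat_adjoint U * U) $$ (i, j) = 1\<^sub>m n $$ (i, j)" using i j by simp
  qed (use U in auto)
  then show ?thesis using that[OF U _ col[of 0, unfolded ws0]] n by simp
qed

lemma unitary_right_inverse:
  fixes U :: "complex mat"
  assumes "U \<in> carrier_mat n n" "mat_adjoint U * U = 1\<^sub>m n"
  shows "U * mat_adjoint U = 1\<^sub>m n"
  using mat_mult_left_right_inverse[OF mat_adjoint_carrier[OF assms(1)] assms] .

text \<open>Induction on the dimension by deflation: in an orthonormal basis that starts with an
  eigenvector, a Hermitian matrix splits into a 1 x 1 block and a smaller Hermitian block. The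
  diagonal \<open>d\<close> is complex here; in the application its reality comes from the bound on
  the spectrum.\<close>

theorem hermitian_mat_spectral_theorem:
  assumes "A \<in> carrier_mat n n" "hermitian_mat A"
  shows "\<exists>U d. U \<in> carrier_mat n n \<and> mat_adjoint U * U = 1\<^sub>m n \<and>
    A = U * mat_diag n d * mat_adjoint U"
  using assms
proof (induction n arbitrary: A)
  case 0
  then show ?case
    by (intro exI[of _ "1\<^sub>m 0"] exI[of _ "\<lambda>_. 0"]) (auto intro!: eq_matI)
next
  case (Suc n)
  note A = Suc.prems(1)
  have herm: "mat_adjoint A = A" using Suc.prems by (simp add: hermitian_mat_def)
  obtain e v where "eigenvector A v e"
    using spectrum_non_empty[OF A] by (auto simp: spectrum_def eigenvalue_def)
  then have v: "v \<in> carrier_vec (Suc n)" "v \<noteq> 0\<^sub>v (Suc n)" "A *\<^sub>v v = e \<cdot>\<^sub>v v"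
    using A by (auto simp: eigenvector_def)
  obtain U c where U: "U \<in> carrier_mat (Suc n) (Suc n)" "mat_adjoint U * U = 1\<^sub>m (Suc n)"
    "col U 0 = c \<cdot>\<^sub>v v"
    using unitary_with_first_column[OF v(1,2)] .
  note U' = mat_adjoint_carrier[OF U(1)]
  note UU = unitary_right_inverse[OF U(1,2)]
  \<comment> \<open>\<open>A\<close> in the basis of the columns of \<open>U\<close>. The first of
    them is an eigenvector, so the first column of \<open>A'\<close> is \<open>e\<close> times the
    first unit vector.\<close>
  define A' where "A' = mat_adjoint U * (A * U)"
  have A': "A' \<in> carrier_mat (Suc n) (Suc n)" unfolding A'_def using A U(1) U' by (intro mult_carrier_mat)
  have "mat_adjoint A' = A'"
    unfolding A'_def using A U(1) U' herm
    by (simp add: mat_adjoint_mult[of _ "Suc n" "Suc n" _ "Suc n"]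
        assoc_mult_mat[of _ "Suc n" "Suc n" _ "Suc n" _ "Suc n"]
        mult_carrier_mat[of _ "Suc n" "Suc n" _ "Suc n"])
  then have herm': "hermitian_mat A'" using A' by (auto simp: hermitian_mat_def)
  have u0: "col U 0 \<in> carrier_vec (Suc n)" using U(1) by (intro carrier_vecI) simp
  have "col A' 0 = mat_adjoint U *\<^sub>v (A *\<^sub>v col U 0)"
    unfolding A'_def using col_mult2[OF U' mult_carrier_mat[OF A U(1)], of 0] col_mult2[OF A U(1), of 0]
    by simp
  also have "A *\<^sub>v col U 0 = e \<cdot>\<^sub>v col U 0"
    using A v by (simp add: U(3) mult_mat_vec smult_smult_assoc mult.commute)
  also have "mat_adjoint U *\<^sub>v (e \<cdot>\<^sub>v col U 0) = e \<cdot>\<^sub>v col (mat_adjoint U * U) 0"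
    using U(1) U' u0 by (simp add: mult_mat_vec[of _ "Suc n" "Suc n"]
        col_mult2[of _ "Suc n" "Suc n" _ "Suc n"])
  finally have col: "col A' 0 = e \<cdot>\<^sub>v col (1\<^sub>m (Suc n)) 0" by (simp add: U(2))
  then have col0: "A' $$ (i, 0) = (if i = 0 then e else 0)" if "i < Suc n" for i
  proof -
    have "A' $$ (i, 0) = col A' 0 $ i" using that A' by simp
    then show ?thesis unfolding col using that by simp
  qed
  \<comment> \<open>Hermitian symmetry carries the zeros of the first column over to the first row,
    which decouples the lower right block \<open>A3\<close>.\<close>
  have row0: "A' $$ (0, j) = (if j = 0 then e else 0)" if "j < Suc n" for j
  proof (cases "j = 0")
    case False
    have "A' $$ (0, j) = cnj (A' $$ (j, 0))"
      using herm' that unfolding hermitian_mat_iff[OF A'] by blast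
    then show ?thesis using False col0[OF that] by simp
  qed (use col0[of 0] in simp)
  define A3 where "A3 = mat n n (\<lambda>(i, j). A' $$ (Suc i, Suc j))"
  have A3: "A3 \<in> carrier_mat n n" by (simp add: A3_def)
  have "hermitian_mat A3"
    using herm' unfolding hermitian_mat_iff[OF A'] hermitian_mat_iff[OF A3]
    unfolding A3_def by (metis (no_types, lifting) Suc_mono case_prod_conv index_mat(1))
  from Suc.IH[OF A3 this] obtain V d where V: "V \<in> carrier_mat n n"
    "mat_adjoint V * V = 1\<^sub>m n" "A3 = V * mat_diag n d * mat_adjoint V"
    by blast
  note V' = mat_adjoint_carrier[OF V(1)]
  \<comment> \<open>The diagonalising unitary of \<open>A3\<close>, extended by the identity on the
    eigenvector already split off.\<close>
  define W where "W = four_block_mat (1\<^sub>m 1) (0\<^sub>m 1 n) (0\<^sub>m n 1) V"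
  have W: "W \<in> carrier_mat (Suc n) (Suc n)"
    unfolding W_def using four_block_carrier_mat[of "1\<^sub>m 1" 1 1 V n n] V(1) by simp
  note W' = mat_adjoint_carrier[OF W]
  have adjW: "mat_adjoint W = four_block_mat (1\<^sub>m 1) (0\<^sub>m 1 n) (0\<^sub>m n 1) (mat_adjoint V)"
    unfolding W_def using V(1) by (intro eq_matI) auto
  have WW: "mat_adjoint W * W = 1\<^sub>m (Suc n)"
    unfolding adjW unfolding W_def using V V'
    by (subst mult_four_block_mat[of _ 1 1 _ n _ n]) auto
  \<comment> \<open>\<open>case_nat e d\<close> places \<open>e\<close> at position 0 and shifts
    \<open>d\<close> by one.\<close>
  define D where "D = mat_diag (Suc n) (case_nat e d)"
  have D: "D = four_block_mat (mat_diag 1 (\<lambda>_. e)) (0\<^sub>m 1 n) (0\<^sub>m n 1) (mat_diag n d)"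
    unfolding D_def by (rule eq_matI) (auto simp: mat_diag_def split: nat.split)
  have Dc: "D \<in> carrier_mat (Suc n) (Suc n)" by (simp add: D_def)
  have VD: "V * mat_diag n d \<in> carrier_mat n n" using V(1) by (intro mult_carrier_mat) auto
  have WD: "W * D = four_block_mat (mat_diag 1 (\<lambda>_. e)) (0\<^sub>m 1 n) (0\<^sub>m n 1) (V * mat_diag n d)"
    unfolding W_def D using V
    by (subst mult_four_block_mat[of _ 1 1 _ n _ n _ _ 1 _ n])
      (auto simp: left_mult_one_mat[of _ "Suc 0" "Suc 0"]
        left_mult_zero_mat[of "mat_diag m f" m m for m f])
  have "A' = four_block_mat (mat_diag 1 (\<lambda>_. e)) (0\<^sub>m 1 n) (0\<^sub>m n 1) A3"
    using A' col0 row0 by (intro eq_matI) (auto simp: mat_diag_def A3_def)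
  also have "\<dots> = W * D * mat_adjoint W"
    unfolding WD adjW using V V' VD mult_carrier_mat[OF VD V']
    by (subst mult_four_block_mat[of _ 1 1 _ n _ n _ _ 1 _ n])
      (auto simp: right_mult_one_mat[of _ "Suc 0" "Suc 0"]
        right_mult_zero_mat[OF VD]
        right_mult_zero_mat[of "mat_diag m f" m m for m f])
  finally have A'_eq: "A' = W * D * mat_adjoint W" .
  have "A = (U * mat_adjoint U) * A * (U * mat_adjoint U)"
    unfolding UU left_mult_one_mat[OF A] right_mult_one_mat[OF A] ..
  also have "\<dots> = U * A' * mat_adjoint U"
    unfolding A'_def using A U(1) U'
    by (simp add: assoc_mult_mat[of _ "Suc n" "Suc n" _ "Suc n" _ "Suc n"]
        mult_carrier_mat[of _ "Suc n" "Suc n" _ "Suc n"])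
  \<comment> \<open>Undoing the change of basis shows that \<open>U * W\<close> is the unitary
    sought.\<close>
  also have "\<dots> = (U * W) * D * mat_adjoint (U * W)"
    unfolding A'_eq using Dc U(1) U' W W'
    by (simp add: assoc_mult_mat[of _ "Suc n" "Suc n" _ "Suc n" _ "Suc n"]
        mult_carrier_mat[of _ "Suc n" "Suc n" _ "Suc n"]
        mat_adjoint_mult[of _ "Suc n" "Suc n" _ "Suc n"])
  finally have eq: "A = (U * W) * D * mat_adjoint (U * W)" .
  have "mat_adjoint (U * W) * (U * W) = mat_adjoint W * ((mat_adjoint U * U) * W)"
    using U(1) U' W W'
    by (simp add: assoc_mult_mat[of _ "Suc n" "Suc n" _ "Suc n" _ "Suc n"]
        mult_carrier_mat[of _ "Suc n" "Suc n" _ "Suc n"]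
        mat_adjoint_mult[of _ "Suc n" "Suc n" _ "Suc n"])
  also have "\<dots> = 1\<^sub>m (Suc n)" using U(2) W WW by simp
  finally show ?case
    using eq U(1) W unfolding D_def by (intro exI[of _ "U * W"] exI[of _ "case_nat e d"]) simp
qed

section \<open>Functional calculus in a fixed orthonormal eigenbasis\<close>

text \<open>Evaluates the option in \<open>mat_int_power\<close>: for square matrices a right
  inverse is two-sided, so \<open>A\<close> is a unit, \<open>mat_inverse\<close> succeeds, and
  inverses are unique.\<close>

lemma mat_inverse_eqI:
  fixes A B :: "'a :: field mat"
  assumes A: "A \<in> carrier_mat n n" and B: "B \<in> carrier_mat n n" and AB: "A * B = 1\<^sub>m n"
  shows "mat_inverse A = Some B"
proof -
  have BA: "B * A = 1\<^sub>m n" using mat_mult_left_right_inverse[OF A B AB] .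
  have "A \<in> Units (ring_mat TYPE('a) n undefined)"
    using A B AB BA by (auto simp: Units_def ring_mat_def)
  then obtain C where C: "mat_inverse A = Some C"
    using mat_inverse(1)[OF A, where b = undefined] by blast
  from mat_inverse(2)[OF A this] have "C * A = 1\<^sub>m n" "C \<in> carrier_mat n n" by auto
  then have "C = B" using assoc_mult_mat[of C n n A n B n] A B by (simp add: AB)
  then show ?thesis using C by simp
qed

text \<open>The functional calculus of a matrix diagonalised by a unitary \<open>U\<close>. The
  function \<open>f\<close> takes positions in the eigenbasis rather than eigenvalues, so repeated
  eigenvalues need no grouping.\<close>

definition diag_conj :: "complex mat \<Rightarrow> (nat \<Rightarrow> complex) \<Rightarrow> complex mat" where
  "diag_conj U f = U * mat_diag (dim_col U) f * mat_adjoint U"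

context
  fixes U :: "complex mat" and n :: nat
  assumes U: "U \<in> carrier_mat n n" and unitary: "mat_adjoint U * U = 1\<^sub>m n"
begin

lemma diag_conj_carrier [simp]: "diag_conj U f \<in> carrier_mat n n"
  using U by (auto simp: diag_conj_def intro!: mult_carrier_mat[of _ n n])

lemma diag_conj_dim [simp]: "dim_row (diag_conj U f) = n" "dim_col (diag_conj U f) = n"
  using diag_conj_carrier by blast+

text \<open>The rank one expansion, entry by entry. It is linear in \<open>f\<close>, from which
  additivity and homogeneity are read off.\<close>

lemma diag_conj_index:
  assumes "i < n" "j < n"
  shows "diag_conj U f $$ (i, j) = (\<Sum>s<n. f s * (U $$ (i, s) * cnj (U $$ (j, s))))"
proof -
  have *: "diag_conj U f = mat n n (\<lambda>(i, j). U $$ (i, j) * f j) * mat_adjoint U"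
    unfolding diag_conj_def using U mat_diag_mult_right[OF U] by simp
  show ?thesis
    unfolding * using U assms
    by (auto simp: scalar_prod_def atLeast0LessThan intro!: sum.cong)
qed

lemma diag_conj_cong: "(\<And>s. s < n \<Longrightarrow> f s = g s) \<Longrightarrow> diag_conj U f = diag_conj U g"
  by (rule eq_matI) (auto simp: diag_conj_index)

lemma diag_conj_add: "diag_conj U (\<lambda>s. f s + g s) = diag_conj U f + diag_conj U g"
  by (intro eq_matI) (auto simp: diag_conj_index sum.distrib algebra_simps)

lemma diag_conj_smult: "diag_conj U (\<lambda>s. c * f s) = c \<cdot>\<^sub>m diag_conj U f"
  by (intro eq_matI) (auto simp: diag_conj_index sum_distrib_left algebra_simps)

lemma diag_conj_one: "diag_conj U (\<lambda>_. 1) = 1\<^sub>m n"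
  using U unitary_right_inverse[OF U unitary] by (simp add: diag_conj_def)

text \<open>The inner factor \<open>mat_adjoint U * U\<close> cancels and diagonal matrices multiply
  pointwise.\<close>

lemma diag_conj_mult: "diag_conj U f * diag_conj U g = diag_conj U (\<lambda>s. f s * g s)"
proof -
  let ?F = "mat_diag n f" and ?G = "mat_diag n g"
  note U' = mat_adjoint_carrier[OF U]
  have "diag_conj U f * diag_conj U g = U * ?F * ((mat_adjoint U * U) * (?G * mat_adjoint U))"
    unfolding diag_conj_def using U U' by (simp add: left_mult_one_mat[of _ n n]
        right_mult_one_mat[of _ n n]
        assoc_mult_mat[of _ n n _ n _ n]
        mult_carrier_mat[of _ n n _ n])
  also have "\<dots> = U * (?F * ?G) * mat_adjoint U"
    unfolding unitary using U U' by (simp add: left_mult_one_mat[of _ n n]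
        right_mult_one_mat[of _ n n]
        assoc_mult_mat[of _ n n _ n _ n]
        mult_carrier_mat[of _ n n _ n] del: mat_diag_diag)
  finally show ?thesis using U by (simp add: diag_conj_def)
qed

lemma diag_conj_pow: "diag_conj U f ^\<^sub>m i = diag_conj U (\<lambda>s. f s ^ i)"
proof (induction i)
  case 0
  show ?case by (simp add: diag_conj_one)
qed (simp add: diag_conj_mult mult.commute)

lemma hermitian_diag_conj: "hermitian_mat (diag_conj U (\<lambda>s. complex_of_real (f s)))"
  unfolding hermitian_mat_iff[OF diag_conj_carrier]
  by (auto simp: diag_conj_index cnj_sum mult.commute)

text \<open>Columns of \<open>U\<close> are unit eigenvectors; testing \<open>A\<close> on them
  turns the hypotheses on its spectrum and definiteness into conditions on each diagonal
  value.\<close>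

lemma diag_conj_eigenvector:
  assumes s: "s < n"
  shows "diag_conj U f *\<^sub>v col U s = f s \<cdot>\<^sub>v col U s" "col U s \<bullet>c col U s = 1"
proof -
  note U' = mat_adjoint_carrier[OF U]
  have "diag_conj U f * U = U * mat_diag n f"
    unfolding diag_conj_def using U U' unitary by (simp add: left_mult_one_mat[of _ n n]
        right_mult_one_mat[of _ n n]
        assoc_mult_mat[of _ n n _ n _ n]
        mult_carrier_mat[of _ n n _ n])
  then have "diag_conj U f *\<^sub>v col U s = col (U * mat_diag n f) s"
    using col_mult2[OF diag_conj_carrier U s, of f] by simp
  also have "\<dots> = f s \<cdot>\<^sub>v col U s"
    using U s by (intro eq_vecI) (auto simp: mat_diag_mult_right[OF U] mult.commute)
  finally show "diag_conj U f *\<^sub>v col U s = f s \<cdot>\<^sub>v col U s" .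
  have "col U s \<bullet>c col U s = (mat_adjoint U * U) $$ (s, s)"
    using U s by (auto simp: scalar_prod_def mult.commute)
  then show "col U s \<bullet>c col U s = 1" using s by (simp add: unitary)
qed

lemma mat_int_power_diag_conj:
  assumes "\<And>s. s < n \<Longrightarrow> d s \<noteq> 0"
  shows "mat_int_power (diag_conj U d) z = diag_conj U (\<lambda>s. d s powi z)"
proof -
  have "diag_conj U d * diag_conj U (\<lambda>s. inverse (d s)) = 1\<^sub>m n"
    unfolding diag_conj_mult diag_conj_one[symmetric] by (rule diag_conj_cong) (simp add: assms)
  then have "mat_inverse (diag_conj U d) = Some (diag_conj U (\<lambda>s. inverse (d s)))"
    by (intro mat_inverse_eqI[of _ n]) auto
  then show ?thesis
    by (simp add: mat_int_power_def power_int_def diag_conj_pow)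
qed

section \<open>Spectral projections and their images under a linear map\<close>

text \<open>For \<open>s < n\<close>, the orthogonal projection onto the line spanned by column
  \<open>s\<close> of \<open>U\<close>.\<close>

definition spectral_proj :: "nat \<Rightarrow> complex mat" where
  "spectral_proj s = diag_conj U (\<lambda>t. if t = s then 1 else 0)"

lemma spectral_proj_carrier [simp]: "spectral_proj s \<in> carrier_mat n n"
  by (simp add: spectral_proj_def)

lemma pos_semidef_spectral_proj: "pos_semidef_mat (spectral_proj s)"
proof (rule pos_semidef_mat_hermitian_idem[OF spectral_proj_carrier])
  show "hermitian_mat (spectral_proj s)"
    using hermitian_diag_conj[of "\<lambda>t. if t = s then 1 else 0"]
    by (simp add: spectral_proj_def if_distrib cong: if_cong)
  show "spectral_proj s * spectral_proj s = spectral_proj s"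
    unfolding spectral_proj_def diag_conj_mult by (rule diag_conj_cong) simp
qed

text \<open>Expand in the spectral projections and apply linearity. Working with entries avoids
  finite sums of matrices.\<close>

lemma linear_mat_map_diag_conj:
  assumes lin: "linear_mat_map n k \<Phi>" and pq: "p < k" "q < k"
  shows "\<Phi> (diag_conj U f) $$ (p, q) = (\<Sum>s<n. f s * \<Phi> (spectral_proj s) $$ (p, q))"
proof -
  have car: "\<Phi> X \<in> carrier_mat k k" if "X \<in> carrier_mat n n" for X
    using lin that by (simp add: linear_mat_map_def)
  have add: "\<Phi> (X + Y) = \<Phi> X + \<Phi> Y" if "X \<in> carrier_mat n n" "Y \<in> carrier_mat n n" for X Y
    using lin that by (simp add: linear_mat_map_def)
  have smult: "\<Phi> (c \<cdot>\<^sub>m X) = c \<cdot>\<^sub>m \<Phi> X" if "X \<in> carrier_mat n n" for c X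
    using lin that by (simp add: linear_mat_map_def)
  \<comment> \<open>Additivity is available for two summands only, so \<open>f\<close> is truncated
    at \<open>l\<close> and one projection is added at a time.\<close>
  have "\<Phi> (diag_conj U (\<lambda>s. if s < l then f s else 0)) $$ (p, q)
      = (\<Sum>s<l. f s * \<Phi> (spectral_proj s) $$ (p, q))" for l
  proof (induction l)
    case 0
    \<comment> \<open>Writing the zero matrix as 0 times itself lets homogeneity show that its image
      vanishes.\<close>
    have "diag_conj U (\<lambda>s. 0) = 0 \<cdot>\<^sub>m diag_conj U (\<lambda>s. 0)"
      using diag_conj_smult[of 0 "\<lambda>_. 0"] by simp
    then have "\<Phi> (diag_conj U (\<lambda>s. 0)) = 0 \<cdot>\<^sub>m \<Phi> (diag_conj U (\<lambda>s. 0))"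
      using smult[OF diag_conj_carrier] by metis
    then have "\<Phi> (diag_conj U (\<lambda>s. 0)) $$ (p, q)
        = (0 \<cdot>\<^sub>m \<Phi> (diag_conj U (\<lambda>s. 0))) $$ (p, q)"
      by simp
    then show ?case using car[OF diag_conj_carrier, of "\<lambda>s. 0"] pq by simp
  next
    case (Suc l)
    have "diag_conj U (\<lambda>s. if s < Suc l then f s else 0)
        = diag_conj U (\<lambda>s. (if s < l then f s else 0) + f l * (if s = l then 1 else 0))"
      by (rule diag_conj_cong) (auto simp: less_Suc_eq)
    also have "\<dots> = diag_conj U (\<lambda>s. if s < l then f s else 0) + f l \<cdot>\<^sub>m spectral_proj l"
      by (simp add: diag_conj_add diag_conj_smult spectral_proj_def)
    finally show ?case
      using pq Suc.IH car[OF diag_conj_carrier, of "\<lambda>s. if s < l then f s else 0"]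
        car[OF spectral_proj_carrier, of l]
      by (simp add: add smult)
  qed
  from this[of n] show ?thesis
    using diag_conj_cong[of "\<lambda>s. if s < n then f s else 0" f] by simp
qed

end

section \<open>Positivity of sums of scaled blocks\<close>

text \<open>Flat indices \<open>b\<close> are grouped by their position \<open>b mod k\<close>
  inside a block. For \<open>k = 0\<close> the assumption forces \<open>N = 0\<close>, and both
  sides are empty.\<close>

lemma sum_mult_sum_mod:
  fixes h :: "nat \<Rightarrow> 'a :: comm_semiring_0"
  assumes "0 < N \<Longrightarrow> 0 < k"
  shows "(\<Sum>q<k. F q * (\<Sum>b | b < N \<and> b mod k = q. h b)) = (\<Sum>b<N. F (b mod k) * h b)"
proof -
  have "(\<Sum>q<k. F q * (\<Sum>b | b < N \<and> b mod k = q. h b))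
      = (\<Sum>q<k. \<Sum>b | b \<in> {..<N} \<and> b mod k = q. F (b mod k) * h b)"
    by (auto simp: sum_distrib_left intro!: sum.cong)
  also have "\<dots> = (\<Sum>b<N. F (b mod k) * h b)"
    using assms by (intro sum.group) auto
  finally show ?thesis .
qed

text \<open>\<open>Z\<close> is the sum over \<open>s\<close> of \<open>c s\<close> times the
  Kronecker product of the rank one matrix with entries \<open>g s i * g s j\<close> and
  \<open>Q s\<close>. Its form at a block vector with blocks \<open>v_i\<close> is the sum of
  \<open>c s\<close> times the form of \<open>Q s\<close> at the combination of the
  \<open>v_i\<close> with coefficients \<open>g s i\<close>.\<close>

lemma pos_semidef_mat_sum_scaled_blocks:
  fixes Z :: "complex mat" and c :: "nat \<Rightarrow> real" and g :: "nat \<Rightarrow> nat \<Rightarrow> real"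
  assumes Z: "Z \<in> carrier_mat (l * k) (l * k)"
    and Q: "\<And>s. s < n \<Longrightarrow> Q s \<in> carrier_mat k k"
    and psd: "\<And>s. s < n \<Longrightarrow> pos_semidef_mat (Q s)"
    and c: "\<And>s. s < n \<Longrightarrow> 0 \<le> c s"
    and entry: "\<And>a b. a < l * k \<Longrightarrow> b < l * k \<Longrightarrow> Z $$ (a, b) =
      (\<Sum>s<n. of_real (c s * g s (a div k) * g s (b div k)) * Q s $$ (a mod k, b mod k))"
  shows "pos_semidef_mat Z"
proof -
  let ?N = "l * k"
  have k: "0 < k" if "0 < ?N" using that by (cases k) auto
  have md: "a mod k < k" if "a < ?N" for a using that k by fastforce
  have Q_herm: "Q s $$ (p, q) = cnj (Q s $$ (q, p))" if "s < n" "p < k" "q < k" for s p q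
    using psd[OF that(1)] hermitian_mat_iff[OF Q[OF that(1)]] that(2,3)
    unfolding pos_semidef_mat_def by blast
  have "hermitian_mat Z"
    unfolding hermitian_mat_iff[OF Z]
  proof (intro allI impI)
    fix a b assume ab: "a < ?N" "b < ?N"
    have "cnj (Z $$ (b, a)) = (\<Sum>s<n. of_real (c s * g s (b div k) * g s (a div k))
        * cnj (Q s $$ (b mod k, a mod k)))"
      unfolding entry[OF ab(2,1)] by simp
    also have "\<dots> = Z $$ (a, b)"
      unfolding entry[OF ab]
    proof (intro sum.cong refl)
      fix s assume "s \<in> {..<n}"
      then have "Q s $$ (a mod k, b mod k) = cnj (Q s $$ (b mod k, a mod k))"
        using Q_herm[OF _ md md] ab by blast
      then show "of_real (c s * g s (b div k) * g s (a div k)) * cnj (Q s $$ (b mod k, a mod k))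
          = of_real (c s * g s (a div k) * g s (b div k)) * Q s $$ (a mod k, b mod k)"
        by (simp add: ac_simps)
    qed
    finally show "Z $$ (a, b) = cnj (Z $$ (b, a))" by simp
  qed
  moreover have "0 \<le> (Z *\<^sub>v v) \<bullet>c v" if v: "v \<in> carrier_vec ?N" for v
  proof -
    \<comment> \<open>\<open>h s\<close> scales each block of \<open>v\<close> by its coefficient,
      and \<open>w s\<close> adds the scaled blocks up to a single vector of length
      \<open>k\<close>.\<close>
    define h where "h s b = complex_of_real (g s (b div k)) * v $ b" for s b
    define w where "w s = vec k (\<lambda>q. \<Sum>b | b < ?N \<and> b mod k = q. h s b)" for s
    have quad: "(Q s *\<^sub>v w s) \<bullet>c w s
        = (\<Sum>a<?N. \<Sum>b<?N. Q s $$ (a mod k, b mod k) * h s b * cnj (h s a))" if s: "s < n" for s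
    proof -
      have inner: "(\<Sum>q<k. Q s $$ (p, q) * w s $ q) = (\<Sum>b<?N. Q s $$ (p, b mod k) * h s b)" for p
      proof -
        have "(\<Sum>q<k. Q s $$ (p, q) * w s $ q)
            = (\<Sum>q<k. Q s $$ (p, q) * (\<Sum>b | b < ?N \<and> b mod k = q. h s b))"
          by (simp add: w_def)
        also have "\<dots> = (\<Sum>b<?N. Q s $$ (p, b mod k) * h s b)"
          by (rule sum_mult_sum_mod[OF k])
        finally show ?thesis .
      qed
      have "(Q s *\<^sub>v w s) \<bullet>c w s = (\<Sum>p<k. (\<Sum>q<k. Q s $$ (p, q) * w s $ q) * cnj (w s $ p))"
        using Q[OF s] by (auto simp: scalar_prod_def w_def atLeast0LessThan intro!: sum.cong)
      also have "\<dots> = (\<Sum>p<k. (\<Sum>b<?N. Q s $$ (p, b mod k) * h s b)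
          * (\<Sum>a | a < ?N \<and> a mod k = p. cnj (h s a)))"
        by (simp add: inner) (simp add: w_def)
      also have "\<dots> = (\<Sum>a<?N. (\<Sum>b<?N. Q s $$ (a mod k, b mod k) * h s b) * cnj (h s a))"
        by (rule sum_mult_sum_mod[OF k])
      finally show ?thesis by (simp add: sum_distrib_right)
    qed
    have "(Z *\<^sub>v v) \<bullet>c v = (\<Sum>a<?N. \<Sum>b<?N. Z $$ (a, b) * v $ b * cnj (v $ a))"
      using Z v by (auto simp: scalar_prod_def atLeast0LessThan sum_distrib_right intro!: sum.cong)
    \<comment> \<open>The real coefficients \<open>g\<close> are absorbed into \<open>h\<close> and
      its conjugate; the sum over \<open>s\<close> is then moved outermost.\<close>
    also have "\<dots> = (\<Sum>a<?N. \<Sum>b<?N. \<Sum>s<n.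
        of_real (c s) * (Q s $$ (a mod k, b mod k) * h s b * cnj (h s a)))"
      by (auto simp: entry h_def sum_distrib_left sum_distrib_right ac_simps intro!: sum.cong)
    also have "\<dots> = (\<Sum>a<?N. \<Sum>s<n. \<Sum>b<?N.
        of_real (c s) * (Q s $$ (a mod k, b mod k) * h s b * cnj (h s a)))"
      by (intro sum.cong refl sum.swap)
    also have "\<dots> = (\<Sum>s<n. \<Sum>a<?N. \<Sum>b<?N.
        of_real (c s) * (Q s $$ (a mod k, b mod k) * h s b * cnj (h s a)))"
      by (rule sum.swap)
    also have "\<dots> = (\<Sum>s<n. of_real (c s) * ((Q s *\<^sub>v w s) \<bullet>c w s))"
      by (simp add: quad sum_distrib_left)
    also have "\<dots> \<ge> 0"
    proof (rule sum_nonneg)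
      fix s assume "s \<in> {..<n}"
      then have s: "s < n" by simp
      have "w s \<in> carrier_vec (dim_row (Q s))" using Q[OF s] by (simp add: w_def)
      then have "0 \<le> (Q s *\<^sub>v w s) \<bullet>c w s"
        using psd[OF s] by (simp add: pos_semidef_mat_def)
      then show "0 \<le> complex_of_real (c s) * ((Q s *\<^sub>v w s) \<bullet>c w s)"
        using c[OF s] by (intro mult_nonneg_nonneg) (auto simp: less_eq_complex_def)
    qed
    finally show ?thesis .
  qed
  ultimately show ?thesis using Z by (auto simp: pos_semidef_mat_def)
qed

section \<open>The two block inequalities for powers of a positive definite matrix\<close>

theorem theorem2p2:
  fixes n k r :: nat
    and \<Phi> :: "complex mat \<Rightarrow> complex mat"
    and A :: "complex mat"
    and m M :: real
  assumes "linear_mat_map n k \<Phi>"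
    and "positive_mat_map n \<Phi>"
    and "unital_mat_map n k \<Phi>"
    and "A \<in> carrier_mat n n"
    and "hermitian_mat A"
    and "spectrum A \<subseteq> complex_of_real ` {m..M}"
    and "pos_def_mat A"
  shows "pos_semidef_mat (block_mat (r + 1) k
           (\<lambda>i j. \<Phi> (mat_int_power A (int i + int j - 2))
                  - complex_of_real m \<cdot>\<^sub>m \<Phi> (mat_int_power A (int i + int j - 3))))
       \<and> pos_semidef_mat (block_mat (r + 1) k
           (\<lambda>i j. complex_of_real M \<cdot>\<^sub>m \<Phi> (mat_int_power A (int i + int j - 3))
                  - \<Phi> (mat_int_power A (int i + int j - 2))))"
proof -
  note A = assms(4)
  have lin: "linear_mat_map n k \<Phi>" by fact
  obtain U d where U: "U \<in> carrier_mat n n" "mat_adjoint U * U = 1\<^sub>m n"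
    and Ad: "A = U * mat_diag n d * mat_adjoint U"
    using hermitian_mat_spectral_theorem[OF A assms(5)] by blast
  have A_eq: "A = diag_conj U d" using Ad U(1) by (simp add: diag_conj_def)
  define \<mu> where "\<mu> s = Re (d s)" for s
  have ev: "d s = of_real (\<mu> s) \<and> m \<le> \<mu> s \<and> \<mu> s \<le> M \<and> 0 < \<mu> s" if s: "s < n" for s
  proof -
    have u: "col U s \<in> carrier_vec n" using U(1) by auto
    have Au: "A *\<^sub>v col U s = d s \<cdot>\<^sub>v col U s" and uu: "col U s \<bullet>c col U s = 1"
      using diag_conj_eigenvector[OF U s] by (auto simp: A_eq)
    have u0: "col U s \<noteq> 0\<^sub>v n" using uu u by force
    have "d s \<in> spectrum A"
      using A u u0 Au by (auto simp: spectrum_def eigenvalue_def eigenvector_def)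
    then obtain x where "d s = of_real x" "m \<le> x" "x \<le> M" using assms(6) by auto
    moreover have "0 < (A *\<^sub>v col U s) \<bullet>c col U s"
      using assms(7) A u u0 by (auto simp: pos_def_mat_def)
    \<comment> \<open>At a unit eigenvector the quadratic form of \<open>A\<close> equals the
      eigenvalue.\<close>
    then have "0 < d s" using u uu by (simp add: Au)
    ultimately show ?thesis by (auto simp: \<mu>_def less_complex_def)
  qed
  define Q where "Q s = \<Phi> (spectral_proj U s)" for s
  have Q: "Q s \<in> carrier_mat k k" "pos_semidef_mat (Q s)" for s
    using lin assms(2) spectral_proj_carrier[OF U] pos_semidef_spectral_proj[OF U]
    by (auto simp: Q_def linear_mat_map_def positive_mat_map_def)
  have pow: "mat_int_power A z = diag_conj U (\<lambda>s. of_real (\<mu> s powi z))" for z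
  proof -
    have "mat_int_power A z = diag_conj U (\<lambda>s. d s powi z)"
      unfolding A_eq using ev by (intro mat_int_power_diag_conj[OF U]) fastforce
    also have "\<dots> = diag_conj U (\<lambda>s. of_real (\<mu> s powi z))"
      using ev by (intro diag_conj_cong[OF U]) simp
    finally show ?thesis .
  qed
  have car: "\<Phi> (mat_int_power A z) \<in> carrier_mat k k" for z
    using lin diag_conj_carrier[OF U] by (simp add: pow linear_mat_map_def)
  have entry: "\<Phi> (mat_int_power A z) $$ (p, q) = (\<Sum>s<n. of_real (\<mu> s powi z) * Q s $$ (p, q))"
    if "p < k" "q < k" for p q z
    unfolding pow Q_def by (rule linear_mat_map_diag_conj[OF U lin that])
  \<comment> \<open>With \<open>i\<close> and \<open>j\<close> counted from 0 the exponents become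
    \<open>i + j\<close> and \<open>i + j - 1\<close>. The latter is -1 in the corner block, hence
    the division by the nonzero \<mu>.\<close>
  have powi: "\<mu> s powi (int (i + 1) + int (j + 1) - 2) = \<mu> s ^ i * \<mu> s ^ j"
    "\<mu> s powi (int (i + 1) + int (j + 1) - 3) = \<mu> s ^ i * \<mu> s ^ j / \<mu> s" if "s < n" for s i j
  proof -
    have nz: "\<mu> s \<noteq> 0" using ev[OF that] by simp
    have *: "int (i + 1) + int (j + 1) - 2 = int (i + j)"
      "int (i + 1) + int (j + 1) - 3 = int (i + j) - 1"
      by auto
    show "\<mu> s powi (int (i + 1) + int (j + 1) - 2) = \<mu> s ^ i * \<mu> s ^ j"
      unfolding * by (simp only: power_int_of_nat power_add)
    show "\<mu> s powi (int (i + 1) + int (j + 1) - 3) = \<mu> s ^ i * \<mu> s ^ j / \<mu> s"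
      unfolding * using nz
      by (simp only: power_int_diff power_int_of_nat power_add power_int_1_right
          not_False_eq_True simp_thms)
  qed
  have md: "a mod k < k" if "a < (r + 1) * k" for a
    using that by (cases k) auto
  have "pos_semidef_mat (block_mat (r + 1) k
           (\<lambda>i j. \<Phi> (mat_int_power A (int i + int j - 2))
                  - complex_of_real m \<cdot>\<^sub>m \<Phi> (mat_int_power A (int i + int j - 3))))"
    (is "pos_semidef_mat ?Z")
  \<comment> \<open>The weight comes from factoring \<open>x^(i+j) - m * x^(i+j-1)\<close> as
    \<open>(x - m) / x * x^i * x^j\<close> at each eigenvalue \<open>x\<close>; it is nonnegative
    since \<open>m \<le> x\<close> and \<open>0 < x\<close>.\<close>
  proof (rule pos_semidef_mat_sum_scaled_blocks[where Q = Q and n = n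
        and c = "\<lambda>s. (\<mu> s - m) / \<mu> s" and g = "\<lambda>s i. \<mu> s ^ i"])
    show "?Z \<in> carrier_mat ((r + 1) * k) ((r + 1) * k)" by (simp add: block_mat_def)
    fix a b assume ab: "a < (r + 1) * k" "b < (r + 1) * k"
    let ?i = "a div k" and ?j = "b div k"
    have "?Z $$ (a, b) =
      (\<Sum>s<n. of_real (\<mu> s powi (int (?i + 1) + int (?j + 1) - 2)) * Q s $$ (a mod k, b mod k))
      - of_real m * (\<Sum>s<n. of_real (\<mu> s powi (int (?i + 1) + int (?j + 1) - 3)) * Q s $$ (a mod k, b mod k))"
      using ab md[OF ab(1)] md[OF ab(2)] car carrier_matD[OF car]
      unfolding block_mat_def by (simp del: of_nat_add add: entry)
    also have "\<dots> = (\<Sum>s<n. of_real ((\<mu> s - m) / \<mu> s * \<mu> s ^ ?i * \<mu> s ^ ?j) * Q s $$ (a mod k, b mod k))"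
      unfolding sum_distrib_left sum_subtractf[symmetric]
    proof (intro sum.cong refl)
      fix s assume "s \<in> {..<n}"
      then have s: "s < n" by simp
      have "\<mu> s \<noteq> 0" using ev[OF s] by simp
      then show "of_real (\<mu> s powi (int (?i + 1) + int (?j + 1) - 2)) * Q s $$ (a mod k, b mod k)
          - of_real m * (of_real (\<mu> s powi (int (?i + 1) + int (?j + 1) - 3)) * Q s $$ (a mod k, b mod k))
          = of_real ((\<mu> s - m) / \<mu> s * \<mu> s ^ ?i * \<mu> s ^ ?j) * Q s $$ (a mod k, b mod k)"
        unfolding powi[OF s] by (simp add: field_simps)
    qed
    finally show "?Z $$ (a, b) = \<dots>" .
  qed (use Q ev in \<open>auto simp: less_imp_le\<close>)
  moreover have "pos_semidef_mat (block_mat (r + 1) k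
           (\<lambda>i j. complex_of_real M \<cdot>\<^sub>m \<Phi> (mat_int_power A (int i + int j - 3))
                  - \<Phi> (mat_int_power A (int i + int j - 2))))"
    (is "pos_semidef_mat ?Z")
  \<comment> \<open>The same factoring with the upper bound: \<open>M * x^(i+j-1) - x^(i+j)\<close>
    has the weight \<open>(M - x) / x\<close>, nonnegative since \<open>x \<le> M\<close>.\<close>
  proof (rule pos_semidef_mat_sum_scaled_blocks[where Q = Q and n = n
        and c = "\<lambda>s. (M - \<mu> s) / \<mu> s" and g = "\<lambda>s i. \<mu> s ^ i"])
    show "?Z \<in> carrier_mat ((r + 1) * k) ((r + 1) * k)" by (simp add: block_mat_def)
    fix a b assume ab: "a < (r + 1) * k" "b < (r + 1) * k"
    let ?i = "a div k" and ?j = "b div k"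
    have "?Z $$ (a, b) =
      of_real M * (\<Sum>s<n. of_real (\<mu> s powi (int (?i + 1) + int (?j + 1) - 3)) * Q s $$ (a mod k, b mod k))
      - (\<Sum>s<n. of_real (\<mu> s powi (int (?i + 1) + int (?j + 1) - 2)) * Q s $$ (a mod k, b mod k))"
      using ab md[OF ab(1)] md[OF ab(2)] car carrier_matD[OF car]
      unfolding block_mat_def by (simp del: of_nat_add add: entry)
    also have "\<dots> = (\<Sum>s<n. of_real ((M - \<mu> s) / \<mu> s * \<mu> s ^ ?i * \<mu> s ^ ?j) * Q s $$ (a mod k, b mod k))"
      unfolding sum_distrib_left sum_subtractf[symmetric]
    proof (intro sum.cong refl)
      fix s assume "s \<in> {..<n}"
      then have s: "s < n" by simp
      have "\<mu> s \<noteq> 0" using ev[OF s] by simp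
      then show "of_real M * (of_real (\<mu> s powi (int (?i + 1) + int (?j + 1) - 3)) * Q s $$ (a mod k, b mod k))
          - of_real (\<mu> s powi (int (?i + 1) + int (?j + 1) - 2)) * Q s $$ (a mod k, b mod k)
          = of_real ((M - \<mu> s) / \<mu> s * \<mu> s ^ ?i * \<mu> s ^ ?j) * Q s $$ (a mod k, b mod k)"
        unfolding powi[OF s] by (simp add: field_simps)
    qed
    finally show "?Z $$ (a, b) = \<dots>" .
  qed (use Q ev in \<open>auto simp: less_imp_le\<close>)
  ultimately show ?thesis by blast
qed

end
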